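(* Let $m \ge 2$ be an integer, let $H_m = \mathbb{Z}_{\ge 0} \setminus \{1, 2, \ldots, m-1\}$ be the ordinary numerical semigroup with multiplicity $m$, and let $n_m = \lfloor \log_2(\tfrac{1}{3}(m-1)) \rfloor + 2$. Then for every positive integer $\ell$ with $n_m \le \ell \le \tfrac{1}{2}m$, the semigroup $H_m$ has a decomposition into irreducibles of length $\ell$.
   Context: A numerical semigroup is a subset of $\mathbb{Z}_{\ge 0}$ that contains $0$, is closed under addition, and has finite complement in $\mathbb{Z}_{\ge 0}$. A numerical semigroup is irreducible if it cannot be expressed as the intersection of two numerical semigroups properly containing it. A decomposition of a numerical semigroup $S$ into irreducibles is an expression $S = S_1 \cap \cdots \cap S_k$ with each $S_i$ an irreducible numerical semigroup, which is irredundant: $S \ne \bigcap_{i \in I} S_i$ for every proper subset $I \subsetneq \{1,\dots,k\}$. The number $k$ is the length of the decomposition. *)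

theory Defs
  imports Complex_Main
begin

definition numerical_semigroup :: "nat set \<Rightarrow> bool" where
  "numerical_semigroup S \<longleftrightarrow>
     0 \<in> S \<and> (\<forall>a\<in>S. \<forall>b\<in>S. a + b \<in> S) \<and> finite (- S)"

definition irreducible_semigroup :: "nat set \<Rightarrow> bool" where
  "irreducible_semigroup S \<longleftrightarrow>
     numerical_semigroup S \<and>
     \<not> (\<exists>A B. numerical_semigroup A \<and> numerical_semigroup B \<and>
            S \<subset> A \<and> S \<subset> B \<and> S = A \<inter> B)"

text \<open>The components are \<open>T 1, \<dots>, T k\<close>; the values of \<open>T\<close> outside \<open>{1..k}\<close> are irrelevant.
  The empty intersection is \<^term>\<open>UNIV :: nat set\<close>, so the empty index set in the irredundancy
  condition matters only for \<open>S = UNIV\<close>, whose only decomposition is the one with \<open>k = 0\<close>.\<close>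

definition irreducible_decomposition :: "nat set \<Rightarrow> nat \<Rightarrow> (nat \<Rightarrow> nat set) \<Rightarrow> bool" where
  "irreducible_decomposition S k T \<longleftrightarrow>
     (\<forall>i\<in>{1..k}. irreducible_semigroup (T i)) \<and>
     S = (\<Inter>i\<in>{1..k}. T i) \<and>
     (\<forall>I. I \<subset> {1..k} \<longrightarrow> S \<noteq> (\<Inter>i\<in>I. T i))"

definition has_decomposition_of_length :: "nat set \<Rightarrow> nat \<Rightarrow> bool" where
  "has_decomposition_of_length S k \<longleftrightarrow> (\<exists>T. irreducible_decomposition S k T)"

definition ordinary_semigroup :: "nat \<Rightarrow> nat set" where
  "ordinary_semigroup m = UNIV - {1..m - 1}"

text \<open>Integer-valued, since the logarithm is negative for \<open>m < 4\<close>.\<close>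

definition min_length_bound :: "nat \<Rightarrow> int" where
  "min_length_bound m = \<lfloor>log 2 (1 / 3 * (real m - 1))\<rfloor> + 2"

end

theory Submission
  imports Defs "HOL-Computational_Algebra.Primes"
begin

text \<open>
  Put \<open>N = m - 1\<close> and \<open>U = {u. N < 2 * u \<and> u \<le> N}\<close>. A component with Frobenius number \<open>F\<close> is
  determined by its elements below \<open>F / 2\<close>; each such element \<open>a\<close> produces the gap \<open>F - a\<close> above
  \<open>F / 2\<close>. Group \<open>U\<close> by \<open>2\<close>-adic valuation and let \<open>F\<close> be the largest member of valuation \<open>v\<close>.
  Taking as small elements the multiples \<open>a\<close> of \<open>2 ^ (v + 1)\<close> with \<open>F - a \<le> \<theta>\<close>, the component
  of \<open>F\<close> omits every \<open>u \<le> \<theta>\<close> of its valuation class in \<open>U\<close>; each \<open>u > \<theta>\<close> in \<open>U\<close> gets a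
  component of its own. A gap \<open>x \<le> N / 2\<close> is omitted as well, because some \<open>2 ^ k * x\<close> lies in
  \<open>U\<close>. Lowering \<open>\<theta>\<close> by one adds at most one component, so all lengths occur between the number
  of valuation classes, which is at most \<open>n\<^sub>m\<close> for \<open>m \<ge> 3\<close>, and the cardinality of \<open>U\<close>, which
  is \<open>m div 2\<close>.
\<close>

section \<open>Irreducibility and the components\<close>

text \<open>A semigroup properly containing \<open>S\<close> must contain \<open>F\<close>: a new
  element \<open>x\<close> gives \<open>F\<close> as \<open>2 * x\<close> or as
  \<open>x + (F - x)\<close>. So two of them never intersect in \<open>S\<close>. Exempting
  \<open>F / 2\<close> allows even \<open>F\<close>.\<close>

lemma irreducible_semigroupI:
  assumes S: "numerical_semigroup S" and F: "F \<notin> S"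
    and large: "\<And>x. F < x \<Longrightarrow> x \<in> S"
    and sym: "\<And>x. x \<le> F \<Longrightarrow> 2 * x \<noteq> F \<Longrightarrow> x \<in> S \<or> F - x \<in> S"
  shows "irreducible_semigroup S"
proof -
  have F_in: "F \<in> A" if A: "numerical_semigroup A" "S \<subset> A" for A
  proof -
    obtain x where x: "x \<in> A" "x \<notin> S" using A by blast
    have "x \<le> F" using large x by (meson not_le)
    have add: "a + b \<in> A" if "a \<in> A" "b \<in> A" for a b
      using A that unfolding numerical_semigroup_def by blast
    show ?thesis
    proof (cases "2 * x = F")
      case True
      then show ?thesis using add[OF x(1) x(1)] by (simp add: mult_2)
    next
      case False
      then have "F - x \<in> A" using sym[OF \<open>x \<le> F\<close>] x A by blast
      then show ?thesis using add[OF x(1)] \<open>x \<le> F\<close> by fastforce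
    qed
  qed
  show ?thesis
    unfolding irreducible_semigroup_def using S F F_in by blast
qed

text \<open>The negated clause removes exactly the reflections \<open>F - a\<close> of nonzero small
  elements \<open>a\<close>; for \<open>x = F - a\<close> the bound
  \<open>F \<le> a + \<theta>\<close> reads \<open>x \<le> \<theta>\<close>. Both 0 and its
  reflection \<open>F\<close> are handled separately, as \<open>F \<le> \<theta>\<close> may
  fail.\<close>

definition component :: "nat \<Rightarrow> nat \<Rightarrow> nat \<Rightarrow> nat set" where
  "component \<theta> d F = {x. x = 0 \<or> (2 * x < F \<and> d dvd x \<and> F \<le> x + \<theta>) \<or>
     (F < 2 * x \<and> x \<noteq> F \<and> \<not> (x < F \<and> x \<le> \<theta> \<and> d dvd F - x))}"

text \<open>Two small elements sum to a multiple of \<open>d\<close>, which is neither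
  \<open>F / 2\<close>, nor \<open>F\<close>, nor \<open>F\<close> minus a multiple of
  \<open>d\<close>. If small plus large were \<open>F\<close> or a reflected gap, the large summand
  would itself be a gap. Two large elements sum to more than \<open>F\<close>.\<close>

lemma component_add:
  assumes d: "\<not> d dvd F" and a: "a \<in> component \<theta> d F" and b: "b \<in> component \<theta> d F"
  shows "a + b \<in> component \<theta> d F"
proof -
  define low where "low x \<longleftrightarrow> 2 * x < F \<and> d dvd x \<and> F \<le> x + \<theta>" for x
  define high where
    "high x \<longleftrightarrow> F < 2 * x \<and> x \<noteq> F \<and> \<not> (x < F \<and> x \<le> \<theta> \<and> d dvd F - x)" for x
  have mem: "x \<in> component \<theta> d F \<longleftrightarrow> x = 0 \<or> low x \<or> high x" for x
    by (simp add: component_def low_def high_def)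
  have low_low: "low (a + b) \<or> high (a + b)" if "low a" "low b" for a b
  proof -
    have dv: "d dvd a + b" using that by (simp add: low_def)
    have "2 * (a + b) \<noteq> F" using d dv by (metis dvd_mult)
    moreover have "a + b \<noteq> F" using d dv by blast
    moreover have "\<not> d dvd F - (a + b)" if "a + b < F"
      using d dv that by (metis dvd_add le_add_diff_inverse less_imp_le)
    ultimately show ?thesis using that dv by (auto simp: low_def high_def)
  qed
  have low_high: "high (a + b)" if ab: "low a" "high b" for a b
  proof -
    have "a + b \<noteq> F"
    proof
      assume e: "a + b = F"
      then have "F - b = a" "b < F" "b \<le> \<theta>" using ab by (auto simp: low_def high_def)
      then show False using ab by (simp add: low_def high_def)
    qed
    moreover have False if "a + b < F" "a + b \<le> \<theta>" "d dvd F - (a + b)"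
    proof -
      have "F - b = (F - (a + b)) + a" using that by simp
      moreover have "d dvd a" using ab by (simp add: low_def)
      ultimately have "d dvd F - b" using \<open>d dvd F - (a + b)\<close> by (metis dvd_add)
      then show False using that ab by (simp add: high_def)
    qed
    ultimately show ?thesis using ab by (auto simp: high_def)
  qed
  have high_high: "high (a + b)" if "high a" "high b" for a b
    using that by (simp add: high_def)
  show ?thesis
    using a b low_low[of a b] low_high[of a b] low_high[of b a] high_high[of a b]
    unfolding mem by (auto simp: add.commute)
qed

lemma irreducible_component:
  assumes d: "\<not> d dvd F"
  shows "irreducible_semigroup (component \<theta> d F)"
proof (rule irreducible_semigroupI)
  have "- component \<theta> d F \<subseteq> {..F}" by (auto simp: component_def)
  then have "finite (- component \<theta> d F)" using finite_subset by blast
  moreover have "0 \<in> component \<theta> d F" by (simp add: component_def)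
  ultimately show "numerical_semigroup (component \<theta> d F)"
    using component_add[OF d] by (simp add: numerical_semigroup_def)
  have "F \<noteq> 0" using d by (metis dvd_0_right)
  then show "F \<notin> component \<theta> d F" by (simp add: component_def)
  show "x \<in> component \<theta> d F" if "F < x" for x using that by (auto simp: component_def)
  show "x \<in> component \<theta> d F \<or> F - x \<in> component \<theta> d F" if "x \<le> F" "2 * x \<noteq> F" for x
    using that by (auto simp: component_def)
qed

section \<open>2-adic valuations of differences\<close>

abbreviation val2 :: "nat \<Rightarrow> nat" where
  "val2 \<equiv> multiplicity 2"

lemma not_pow_Suc_val2_dvd:
  assumes "x > 0"
  shows "\<not> 2 ^ Suc (val2 x) dvd x"
  using assms by (simp add: power_dvd_iff_le_multiplicity del: power_Suc)

text \<open>This turns the divisibility condition in \<open>component\<close> into equality of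
  valuations. Divided by \<open>2 ^ v\<close>, numbers of valuation \<open>v\<close> become odd, and
  odd numbers differ by an even one.\<close>

lemma pow_Suc_val2_dvd_diff_iff:
  assumes "0 < x" "x < y"
  shows "2 ^ Suc (val2 y) dvd y - x \<longleftrightarrow> val2 x = val2 y"
proof
  assume dvd: "2 ^ Suc (val2 y) dvd y - x"
  have 1: "2 ^ val2 y dvd x"
    using dvd multiplicity_dvd[of 2 y] assms
    by (metis dvd_diffD1 dvd_power_le less_imp_le power_Suc dvd_mult_right dvd_refl)
  have 2: "\<not> 2 ^ Suc (val2 y) dvd x"
    using dvd not_pow_Suc_val2_dvd[of y] assms
    by (metis dvd_diffD le_less_trans less_imp_le zero_le)
  show "val2 x = val2 y"
    by (rule multiplicity_eqI) (use 1 2 in auto)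
next
  assume e: "val2 x = val2 y"
  obtain a where a: "x = 2 ^ val2 x * a" using multiplicity_dvd[of 2 x] by blast
  obtain b where b: "y = 2 ^ val2 x * b" using multiplicity_dvd[of 2 y] unfolding e by blast
  have "odd a" using not_pow_Suc_val2_dvd[of x] assms a
    by (metis dvd_refl mult_dvd_mono power_Suc2)
  moreover have "odd b" using not_pow_Suc_val2_dvd[of y] assms b e
    by (metis dvd_refl less_trans mult_dvd_mono power_Suc2)
  ultimately have "2 dvd b - a" by simp
  then have "2 ^ val2 x * 2 dvd 2 ^ val2 x * (b - a)" by (rule mult_dvd_mono[OF dvd_refl])
  then show "2 ^ Suc (val2 y) dvd y - x"
    using a b e by (metis diff_mult_distrib2 power_Suc2)
qed

section \<open>Special gaps and their valuation classes\<close>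

text \<open>For \<open>N = m - 1\<close> these are the special gaps of
  \<open>ordinary_semigroup m\<close>: those whose adjunction alone gives a semigroup again.\<close>

definition upper_half :: "nat \<Rightarrow> nat set" where
  "upper_half N = {u. N < 2 * u \<and> u \<le> N}"

definition class_maxima :: "nat \<Rightarrow> nat set" where
  "class_maxima N = {u \<in> upper_half N. \<forall>w\<in>upper_half N. val2 w = val2 u \<longrightarrow> w \<le> u}"

lemma finite_upper_half [simp]: "finite (upper_half N)"
  by (rule finite_subset[of _ "{..N}"]) (auto simp: upper_half_def)

lemma card_upper_half: "card (upper_half N) = Suc N div 2"
proof -
  have "upper_half N = {N div 2<..N}" by (auto simp: upper_half_def)
  then show ?thesis by simp
qed

lemma class_maxima_subset: "class_maxima N \<subseteq> upper_half N"
  by (auto simp: class_maxima_def)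

lemma ex_class_maximum:
  assumes "u \<in> upper_half N"
  obtains F where "F \<in> class_maxima N" "val2 F = val2 u" "u \<le> F"
proof -
  let ?C = "{w \<in> upper_half N. val2 w = val2 u}"
  have fin: "finite ?C" by simp
  have "Max ?C \<in> ?C" by (rule Max_in) (use assms in auto)
  moreover have "w \<le> Max ?C" if "w \<in> ?C" for w using that fin by simp
  ultimately show ?thesis using assms that[of "Max ?C"] by (auto simp: class_maxima_def)
qed

text \<open>Doubling a number that is at most \<open>N / 2\<close> cannot jump past
  \<open>N\<close>.\<close>

lemma ex_doubling_in_upper_half:
  assumes "0 < x" "x \<le> N"
  shows "\<exists>k. 2 ^ k * x \<in> upper_half N"
  using assms
proof (induction "N - x" arbitrary: x rule: less_induct)
  case less
  show ?case
  proof (cases "N < 2 * x")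
    case True
    then show ?thesis using less by (intro exI[of _ 0]) (simp add: upper_half_def)
  next
    case False
    then have "\<exists>k. 2 ^ k * (2 * x) \<in> upper_half N"
      using less.prems by (intro less.hyps) auto
    then obtain k where "2 ^ k * (2 * x) \<in> upper_half N" by blast
    then show ?thesis by (intro exI[of _ "Suc k"]) (simp add: mult_ac)
  qed
qed

text \<open>An element of \<open>upper_half N\<close> of valuation at least \<open>K\<close> must be a power of two, and there is
  only one power of two in that range.\<close>

lemma card_class_maxima:
  assumes N: "N < 3 * 2 ^ K"
  shows "card (class_maxima N) \<le> Suc K"
proof -
  define P where "P = {v. (2::nat) ^ v \<in> upper_half N}"
  have inj: "inj_on val2 (class_maxima N)"
    by (rule inj_onI) (auto simp: class_maxima_def intro: antisym)
  have "v \<le> w" if "v \<in> P" "w \<in> P" for v w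
  proof (rule ccontr)
    assume "\<not> v \<le> w"
    then have "(2::nat) ^ Suc w \<le> 2 ^ v" by (intro power_increasing) auto
    then show False using that by (simp add: P_def upper_half_def)
  qed
  then have "P \<subseteq> {w}" if "w \<in> P" for w
    using that by (auto intro: antisym)
  \<comment> \<open>An inclusion also covers \<open>N = 0\<close>, where \<open>P\<close> is
    empty.\<close>
  then have "\<exists>w. P \<subseteq> {w}" by blast
  then obtain w where w: "P \<subseteq> {w}" by blast
  have "val2 ` class_maxima N \<subseteq> insert w {..<K}"
  proof (rule image_subsetI)
    fix u assume "u \<in> class_maxima N"
    then have u: "u \<in> upper_half N" using class_maxima_subset by blast
    then have "u > 0" by (auto simp: upper_half_def)
    obtain a where a: "u = 2 ^ val2 u * a" using multiplicity_dvd[of 2 u] by blast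
    have "odd a" using not_pow_Suc_val2_dvd[OF \<open>u > 0\<close>] a
      by (metis dvd_refl mult_dvd_mono power_Suc2)
    have "val2 u \<in> P" if "K \<le> val2 u"
    proof -
      have "(2::nat) ^ K * a \<le> 2 ^ val2 u * a" using that by (simp add: power_increasing)
      also have "\<dots> < 2 ^ K * 3" using a u N by (simp add: upper_half_def)
      finally have "a < 3" by simp
      then have "a = 1" using \<open>odd a\<close> by (auto simp: less_Suc_eq numeral_eq_Suc)
      then show ?thesis using a u by (simp add: P_def)
    qed
    then show "val2 u \<in> insert w {..<K}" using w by force
  qed
  then have "card (val2 ` class_maxima N) \<le> card (insert w {..<K})"
    by (intro card_mono) auto
  also have "\<dots> \<le> Suc K" using card_insert_le_m1[of "Suc K" "{..<K}" w] by simp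
  finally show ?thesis by (simp add: card_image[OF inj])
qed

section \<open>Tuning the number of components\<close>

lemma ex_threshold:
  assumes "card (class_maxima N) \<le> l" "l \<le> card (upper_half N)"
  shows "\<exists>\<theta>. card (class_maxima N \<union> (upper_half N \<inter> {\<theta><..})) = l"
proof -
  define R where "R \<theta> = class_maxima N \<union> (upper_half N \<inter> {\<theta><..})" for \<theta>
  have fin: "finite (R \<theta>)" for \<theta>
    using class_maxima_subset by (intro finite_subset[of "R \<theta>" "upper_half N"]) (auto simp: R_def)
  have "R N = class_maxima N" by (auto simp: R_def upper_half_def)
  then have ex: "card (R N) \<le> l" using assms by simp
  \<comment> \<open>The count at this \<open>\<theta>\<close> is exactly \<open>l\<close>: for
    \<open>\<theta> = 0\<close> all of \<open>upper_half N\<close> is counted, and otherwise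
    \<open>\<theta> - 1\<close> counts more than \<open>l\<close> elements, at most one of them
    new.\<close>
  define \<theta> where "\<theta> = (LEAST \<theta>. card (R \<theta>) \<le> l)"
  have le: "card (R \<theta>) \<le> l" unfolding \<theta>_def by (rule LeastI) (rule ex)
  have "l \<le> card (R \<theta>)"
  proof (cases \<theta>)
    case 0
    have "R 0 = upper_half N" using class_maxima_subset by (auto simp: R_def upper_half_def)
    then show ?thesis using assms 0 by simp
  next
    case (Suc \<theta>')
    then have "\<not> card (R \<theta>') \<le> l" using not_less_Least[of \<theta>' "\<lambda>\<theta>. card (R \<theta>) \<le> l"]
      by (simp add: \<theta>_def)
    moreover have "R \<theta>' \<subseteq> insert \<theta> (R \<theta>)" using Suc by (auto simp: R_def)
    then have "card (R \<theta>') \<le> card (insert \<theta> (R \<theta>))" by (intro card_mono) (simp_all add: fin)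
    moreover have "card (insert \<theta> (R \<theta>)) \<le> Suc (card (R \<theta>))" 
      by (simp add: card_insert_if fin)
    ultimately show ?thesis by linarith
  qed
  then show ?thesis using le unfolding R_def by (metis antisym)
qed

section \<open>Decompositions of the ordinary semigroup\<close>

text \<open>Irredundance holds because \<open>r\<close> is omitted by \<open>T r\<close> alone:
  leaving out \<open>T r\<close> lets \<open>r\<close> into the intersection.\<close>

lemma has_decomposition_of_lengthI:
  assumes fin: "finite R"
    and irr: "\<And>r. r \<in> R \<Longrightarrow> irreducible_semigroup (T r)"
    and S: "S = (\<Inter>r\<in>R. T r)"
    and own: "\<And>r. r \<in> R \<Longrightarrow> r \<notin> S"
      "\<And>r r'. r \<in> R \<Longrightarrow> r' \<in> R \<Longrightarrow> r \<noteq> r' \<Longrightarrow> r \<in> T r'"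
  shows "has_decomposition_of_length S (card R)"
proof -
  obtain f where f: "bij_betw f {1..card R} R"
    using ex_bij_betw_nat_finite_1[OF fin] by blast
  then have img: "f ` {1..card R} = R" and inj: "inj_on f {1..card R}"
    by (auto simp: bij_betw_def)
  have "irreducible_decomposition S (card R) (T \<circ> f)"
    unfolding irreducible_decomposition_def
  proof (intro conjI ballI allI impI)
    show "irreducible_semigroup ((T \<circ> f) i)" if "i \<in> {1..card R}" for i
      using irr imageI[OF that, of f] unfolding img by simp
    show "S = (\<Inter>i\<in>{1..card R}. (T \<circ> f) i)"
      unfolding S using img by (metis image_comp)
    fix I assume I: "I \<subset> {1..card R}"
    then obtain i where i: "i \<in> {1..card R}" "i \<notin> I" by blast
    have "f i \<in> (T \<circ> f) j" if "j \<in> I" for j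
    proof -
      have j: "j \<in> {1..card R}" using I that by blast
      then have "f i \<noteq> f j" using inj i that by (metis inj_onD)
      then show ?thesis using own(2)[of "f i" "f j"] imageI[OF i(1), of f] imageI[OF j, of f] unfolding img by simp
    qed
    moreover have "f i \<notin> S" using own(1) img i by blast
    ultimately show "S \<noteq> (\<Inter>i\<in>I. (T \<circ> f) i)" by blast
  qed
  then show ?thesis unfolding has_decomposition_of_length_def by blast
qed

lemma ordinary_semigroup_decomposition:
  fixes m \<theta> :: nat
  defines "R \<equiv> class_maxima (m - 1) \<union> (upper_half (m - 1) \<inter> {\<theta><..})"
  shows "has_decomposition_of_length (ordinary_semigroup m) (card R)"
proof -
  define N where "N = m - 1"
  define T where "T r = component \<theta> (2 ^ Suc (val2 r)) r" for r
  have H: "ordinary_semigroup m = {x. x = 0 \<or> N < x}"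
    by (auto simp: ordinary_semigroup_def N_def)
  have R: "R = class_maxima N \<union> (upper_half N \<inter> {\<theta><..})" by (simp add: R_def N_def)
  have RU: "R \<subseteq> upper_half N" using class_maxima_subset by (auto simp: R)
  have pos: "0 < r" "r \<le> N" "N < 2 * r" if "r \<in> upper_half N" for r
    using that by (auto simp: upper_half_def)
  show ?thesis
  proof (rule has_decomposition_of_lengthI)
    show "finite R" using RU by (rule finite_subset) simp
    show "irreducible_semigroup (T r)" if "r \<in> R" for r
      unfolding T_def using that RU pos(1) by (intro irreducible_component not_pow_Suc_val2_dvd) blast
    show "r \<notin> ordinary_semigroup m" if "r \<in> R" for r
      using that RU pos[of r] by (auto simp: H)
    show "r \<in> T r'" if r: "r \<in> R" "r' \<in> R" "r \<noteq> r'" for r r'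
    proof -
      have U: "r \<in> upper_half N" "r' \<in> upper_half N" using r RU by auto
      \<comment> \<open>The only obstacle is that \<open>r\<close> is a reflected gap of
        \<open>T r'\<close>. But \<open>r \<le> \<theta>\<close> lies in \<open>R\<close> only as
        the maximum of its class, which would contain the larger \<open>r'\<close>.\<close>
      have False if lt: "r < r'" and "r \<le> \<theta>" "2 ^ Suc (val2 r') dvd r' - r"
      proof -
        have "val2 r = val2 r'" using pow_Suc_val2_dvd_diff_iff pos(1) U that by blast
        moreover have "r \<in> class_maxima N" using r \<open>r \<le> \<theta>\<close> by (auto simp: R)
        ultimately show False using U lt by (auto simp: class_maxima_def)
      qed
      moreover have "r' < 2 * r" using pos[OF U(1)] pos[OF U(2)] by linarith
      ultimately show ?thesis using r unfolding T_def component_def by blast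
    qed
    show "ordinary_semigroup m = (\<Inter>r\<in>R. T r)"
    proof (intro equalityI subsetI)
      fix x assume "x \<in> ordinary_semigroup m"
      then have "x = 0 \<or> r < x" if "r \<in> R" for r
        using that RU pos(2)[of r] by (auto simp: H)
      then show "x \<in> (\<Inter>r\<in>R. T r)" by (fastforce simp: T_def component_def)
    next
      fix x assume x: "x \<in> (\<Inter>r\<in>R. T r)"
      show "x \<in> ordinary_semigroup m"
      proof (rule ccontr)
        assume "x \<notin> ordinary_semigroup m"
        then have x0: "0 < x" "x \<le> N" by (auto simp: H)
        have "\<exists>r\<in>R. x \<notin> T r"
        proof (cases "x \<in> upper_half N")
          case True
          show ?thesis
          proof (cases "x \<in> R")
            case True
            then show ?thesis
              using not_pow_Suc_val2_dvd[OF x0(1)] x0 by (intro bexI[of _ x]) (auto simp: T_def component_def)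
          next
            case False
            obtain F where F: "F \<in> class_maxima N" "val2 F = val2 x" "x \<le> F"
              using ex_class_maximum[OF True] by blast
            have "x < F" using F False by (auto simp: R order.order_iff_strict)
            moreover have "x \<le> \<theta>" using False True by (auto simp: R)
            moreover have "2 ^ Suc (val2 F) dvd F - x"
              using pow_Suc_val2_dvd_diff_iff[OF x0(1) \<open>x < F\<close>] F by simp
            moreover have "F < 2 * x"
              using pos(3)[OF True] F class_maxima_subset pos(2)[of F] by fastforce
            ultimately have "x \<notin> T F" using x0 unfolding T_def component_def by auto
            then show ?thesis using F by (auto simp: R)
          qed
        next
          case False
          then have "2 * x \<le> N" using x0 by (auto simp: upper_half_def)
          \<comment> \<open>Starting from \<open>2 * x\<close> ensures \<open>2 * x \<le> F\<close>,
            so \<open>x\<close> could lie in \<open>T F\<close> only as a small element, hence as a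
            multiple of \<open>2 ^ Suc (val2 F)\<close>; but
            \<open>val2 F \<ge> val2 x\<close>.\<close>
          then obtain k where k: "2 ^ k * (2 * x) \<in> upper_half N"
            using ex_doubling_in_upper_half[of "2 * x" N] x0 by auto
          then obtain F where F: "F \<in> class_maxima N" "val2 F = val2 (2 ^ k * (2 * x))"
            "2 ^ k * (2 * x) \<le> F" using ex_class_maximum by blast
          have "val2 (2 ^ k * (2 * x)) \<ge> val2 x"
            using x0 by (intro dvd_imp_multiplicity_le) auto
          then have "\<not> 2 ^ Suc (val2 F) dvd x"
            using x0 F by (simp add: power_dvd_iff_le_multiplicity del: power_Suc)
          moreover have "2 * x \<le> F" using F(3) by (meson dvd_imp_le dvd_triv_right k pos(1) le_trans)
          ultimately have "x \<notin> T F" using x0 unfolding T_def component_def by auto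
          then show ?thesis using F by (auto simp: R)
        qed
        then show False using x by blast
      qed
    qed
  qed
qed

theorem theorem4p3:
  fixes m l :: nat
  assumes "m \<ge> 2"
    and "l \<ge> 1"
    and "min_length_bound m \<le> int l"
    and "real l \<le> 1 / 2 * real m"
  shows "has_decomposition_of_length (ordinary_semigroup m) l"
proof -
  define N where "N = m - 1"
  have N: "real N = real m - 1" "0 < N" "Suc N = m" using assms by (auto simp: N_def)
  \<comment> \<open>This is \<open>min_length_bound m - 1\<close>, cut off at 0. The cut-off takes
    effect only for \<open>m = 2\<close>, where the bound is 0 and \<open>l \<ge> 1\<close> still
    gives \<open>Suc K \<le> l\<close>.\<close>
  define K where "K = nat (\<lfloor>log 2 (real N / 3)\<rfloor> + 1)"
  have "log 2 (real N / 3) < real K" unfolding K_def by linarith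
  then have "real N / 3 < 2 powr real K" using N by (subst (asm) log_less_iff) auto
  then have "real N < real (3 * 2 ^ K)" by (simp add: powr_realpow)
  then have "N < 3 * 2 ^ K" by linarith
  then have "card (class_maxima N) \<le> Suc K" by (rule card_class_maxima)
  also have "Suc K \<le> l" using assms(2,3) N(1) unfolding K_def min_length_bound_def by simp
  finally have "card (class_maxima N) \<le> l" .
  moreover have "l \<le> card (upper_half N)" using assms(4) N by (simp add: card_upper_half)
  ultimately obtain \<theta> where "card (class_maxima N \<union> (upper_half N \<inter> {\<theta><..})) = l"
    using ex_threshold by blast
  then show ?thesis using ordinary_semigroup_decomposition[of m \<theta>] by (simp add: N_def)
qed

end
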